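(* Let $R$ be a PDS ring. Then every $R$-module is pure extending.
   Context: Rings are associative with unity and modules are unital right modules unless specified otherwise. A submodule $P$ of a right $R$-module $M$ is pure in $M$ if for every left $R$-module $N$ the induced map $P\otimes_R N\to M\otimes_R N$ is injective; purity for left modules is defined symmetrically. A ring $R$ is left PDS (respectively right PDS) if every pure submodule of every left (respectively right) $R$-module is a direct summand; $R$ is PDS if it is both left and right PDS. A submodule $N$ of $L$ is essential in $L$ if $N\cap X\neq 0$ for every nonzero submodule $X$ of $L$. An $R$-module $M$ is pure extending if every pure submodule of $M$ is essential in some direct summand of $M$. *)

theory Defs
  imports "HOL-Algebra.Module" "HOL-Algebra.AbelCoset" "HOL-Algebra.Free_Abelian_Groups"
begin

section \<open>Modules over a noncommutative ring\<close>

text \<open>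
  The locale \<^locale>\<open>module\<close> of HOL-Algebra assumes a commutative ring. Its record type is reused
  here. In a right module, \<open>r \<odot>\<^bsub>M\<^esub> x\<close> stands for the product of \<open>x\<close> by \<open>r\<close> on the right,
  so only the associativity law differs from that of a left module.
\<close>

locale left_module = R?: ring R + M?: abelian_group M
  for R :: "('r, 'k) ring_scheme" (structure) and M :: "('r, 'm, 'c) module_scheme" (structure) +
  assumes smult_closed:
      "\<lbrakk>r \<in> carrier R; x \<in> carrier M\<rbrakk> \<Longrightarrow> r \<odot>\<^bsub>M\<^esub> x \<in> carrier M"
    and smult_l_distr:
      "\<lbrakk>r \<in> carrier R; s \<in> carrier R; x \<in> carrier M\<rbrakk> \<Longrightarrow>
        (r \<oplus> s) \<odot>\<^bsub>M\<^esub> x = r \<odot>\<^bsub>M\<^esub> x \<oplus>\<^bsub>M\<^esub> s \<odot>\<^bsub>M\<^esub> x"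
    and smult_r_distr:
      "\<lbrakk>r \<in> carrier R; x \<in> carrier M; y \<in> carrier M\<rbrakk> \<Longrightarrow>
        r \<odot>\<^bsub>M\<^esub> (x \<oplus>\<^bsub>M\<^esub> y) = r \<odot>\<^bsub>M\<^esub> x \<oplus>\<^bsub>M\<^esub> r \<odot>\<^bsub>M\<^esub> y"
    and smult_assoc:
      "\<lbrakk>r \<in> carrier R; s \<in> carrier R; x \<in> carrier M\<rbrakk> \<Longrightarrow>
        (r \<otimes> s) \<odot>\<^bsub>M\<^esub> x = r \<odot>\<^bsub>M\<^esub> (s \<odot>\<^bsub>M\<^esub> x)"
    and smult_one: "x \<in> carrier M \<Longrightarrow> \<one> \<odot>\<^bsub>M\<^esub> x = x"

locale right_module = R?: ring R + M?: abelian_group M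
  for R :: "('r, 'k) ring_scheme" (structure) and M :: "('r, 'm, 'c) module_scheme" (structure) +
  assumes smult_closed:
      "\<lbrakk>r \<in> carrier R; x \<in> carrier M\<rbrakk> \<Longrightarrow> r \<odot>\<^bsub>M\<^esub> x \<in> carrier M"
    and smult_l_distr:
      "\<lbrakk>r \<in> carrier R; s \<in> carrier R; x \<in> carrier M\<rbrakk> \<Longrightarrow>
        (r \<oplus> s) \<odot>\<^bsub>M\<^esub> x = r \<odot>\<^bsub>M\<^esub> x \<oplus>\<^bsub>M\<^esub> s \<odot>\<^bsub>M\<^esub> x"
    and smult_r_distr:
      "\<lbrakk>r \<in> carrier R; x \<in> carrier M; y \<in> carrier M\<rbrakk> \<Longrightarrow>
        r \<odot>\<^bsub>M\<^esub> (x \<oplus>\<^bsub>M\<^esub> y) = r \<odot>\<^bsub>M\<^esub> x \<oplus>\<^bsub>M\<^esub> r \<odot>\<^bsub>M\<^esub> y"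
    and smult_assoc:
      "\<lbrakk>r \<in> carrier R; s \<in> carrier R; x \<in> carrier M\<rbrakk> \<Longrightarrow>
        (r \<otimes> s) \<odot>\<^bsub>M\<^esub> x = s \<odot>\<^bsub>M\<^esub> (r \<odot>\<^bsub>M\<^esub> x)"
    and smult_one: "x \<in> carrier M \<Longrightarrow> \<one> \<odot>\<^bsub>M\<^esub> x = x"

definition direct_summand ::
    "('r, 'k) ring_scheme \<Rightarrow> ('r, 'm) module \<Rightarrow> 'm set \<Rightarrow> bool" where
  "direct_summand R M D \<longleftrightarrow> submodule D R M \<and>
     (\<exists>Q. submodule Q R M \<and> D \<inter> Q = {\<zero>\<^bsub>M\<^esub>} \<and> D <+>\<^bsub>M\<^esub> Q = carrier M)"

definition essential ::
    "('r, 'k) ring_scheme \<Rightarrow> ('r, 'm) module \<Rightarrow> 'm set \<Rightarrow> bool" where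
  "essential R L N \<longleftrightarrow> submodule N R L \<and>
     (\<forall>X. submodule X R L \<and> X \<noteq> {\<zero>\<^bsub>L\<^esub>} \<longrightarrow> N \<inter> X \<noteq> {\<zero>\<^bsub>L\<^esub>})"


section \<open>Tensor products\<close>

text \<open>
  \<open>M\<close> is a right module and \<open>N\<close> a left module; the tensor product is the free abelian group on
  \<open>carrier M \<times> carrier N\<close> modulo the subgroup generated by the relations.
\<close>

definition tensor_relations ::
    "('r, 'k) ring_scheme \<Rightarrow> ('r, 'm) module \<Rightarrow> ('r, 'n) module \<Rightarrow> ('m \<times> 'n \<Rightarrow>\<^sub>0 int) set" where
  "tensor_relations R M N =
     {frag_of (x \<oplus>\<^bsub>M\<^esub> y, n) - frag_of (x, n) - frag_of (y, n) | x y n.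
        x \<in> carrier M \<and> y \<in> carrier M \<and> n \<in> carrier N} \<union>
     {frag_of (x, n \<oplus>\<^bsub>N\<^esub> p) - frag_of (x, n) - frag_of (x, p) | x n p.
        x \<in> carrier M \<and> n \<in> carrier N \<and> p \<in> carrier N} \<union>
     {frag_of (r \<odot>\<^bsub>M\<^esub> x, n) - frag_of (x, r \<odot>\<^bsub>N\<^esub> n) | r x n.
        r \<in> carrier R \<and> x \<in> carrier M \<and> n \<in> carrier N}"

definition tensor_kernel ::
    "('r, 'k) ring_scheme \<Rightarrow> ('r, 'm) module \<Rightarrow> ('r, 'n) module \<Rightarrow> ('m \<times> 'n \<Rightarrow>\<^sub>0 int) set" where
  "tensor_kernel R M N =
     generate (free_Abelian_group (carrier M \<times> carrier N)) (tensor_relations R M N)"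

definition tensor_product ::
    "('r, 'k) ring_scheme \<Rightarrow> ('r, 'm) module \<Rightarrow> ('r, 'n) module \<Rightarrow> ('m \<times> 'n \<Rightarrow>\<^sub>0 int) set monoid"
  where
  "tensor_product R M N =
     free_Abelian_group (carrier M \<times> carrier N) Mod tensor_kernel R M N"

definition tensor ::
    "('r, 'k) ring_scheme \<Rightarrow> ('r, 'm) module \<Rightarrow> ('r, 'n) module \<Rightarrow> 'm \<Rightarrow> 'n \<Rightarrow>
      ('m \<times> 'n \<Rightarrow>\<^sub>0 int) set" where
  "tensor R M N x n =
     tensor_kernel R M N #>\<^bsub>free_Abelian_group (carrier M \<times> carrier N)\<^esub> frag_of (x, n)"

definition frag_pair_map ::
    "('a \<Rightarrow> 'm) \<Rightarrow> ('b \<Rightarrow> 'n) \<Rightarrow> ('a \<times> 'b \<Rightarrow>\<^sub>0 int) \<Rightarrow> ('m \<times> 'n \<Rightarrow>\<^sub>0 int)" where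
  "frag_pair_map f g = frag_extend (\<lambda>(x, n). frag_of (f x, g n))"

text \<open>
  The map induced by \<open>f\<close> and \<open>g\<close> on tensor products, with codomain \<open>tensor_product R M N\<close>: adding
  \<open>tensor_kernel R M N\<close> turns the image of a coset into a full coset. See \<open>tensor_map_hom\<close> and
  \<open>tensor_map_tensor\<close> below.
\<close>

definition tensor_map ::
    "('r, 'k) ring_scheme \<Rightarrow> ('r, 'm) module \<Rightarrow> ('r, 'n) module \<Rightarrow> ('a \<Rightarrow> 'm) \<Rightarrow> ('b \<Rightarrow> 'n) \<Rightarrow>
      ('a \<times> 'b \<Rightarrow>\<^sub>0 int) set \<Rightarrow> ('m \<times> 'n \<Rightarrow>\<^sub>0 int) set" where
  "tensor_map R M N f g A =
     tensor_kernel R M N <#>\<^bsub>free_Abelian_group (carrier M \<times> carrier N)\<^esub> (frag_pair_map f g ` A)"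


section \<open>Purity, PDS rings, pure extending modules\<close>

text \<open>
  A definition in HOL cannot quantify over types, so the test modules \<open>N\<close> have their carrier in
  the type \<open>'r list\<close>, which contains a copy of every finitely generated module. This is no
  restriction: \<open>right_pure_all\<close> and \<open>left_pure_all\<close> below show that injectivity then holds for
  test modules in every type.
\<close>

definition right_pure ::
    "('r, 'k) ring_scheme \<Rightarrow> ('r, 'm) module \<Rightarrow> 'm set \<Rightarrow> bool" where
  "right_pure R M P \<longleftrightarrow> submodule P R M \<and>
     (\<forall>N :: ('r, 'r list) module. left_module R N \<longrightarrow>
        inj_on (tensor_map R M N (\<lambda>x. x) (\<lambda>n. n))
          (carrier (tensor_product R (M\<lparr>carrier := P\<rparr>) N)))"

definition left_pure ::
    "('r, 'k) ring_scheme \<Rightarrow> ('r, 'm) module \<Rightarrow> 'm set \<Rightarrow> bool" where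
  "left_pure R M P \<longleftrightarrow> submodule P R M \<and>
     (\<forall>N :: ('r, 'r list) module. right_module R N \<longrightarrow>
        inj_on (tensor_map R N M (\<lambda>n. n) (\<lambda>x. x))
          (carrier (tensor_product R N (M\<lparr>carrier := P\<rparr>))))"

text \<open>
  For the same reason PDS takes the type \<open>'m\<close> of the modules as a parameter: it is assumed for
  modules in \<open>'m\<close> only, and results that assume it are stated for modules in the same, arbitrary
  type \<open>'m\<close>. Purity itself does not depend on this parameter.
\<close>

definition left_PDS :: "'m itself \<Rightarrow> ('r, 'k) ring_scheme \<Rightarrow> bool" where
  "left_PDS (_ :: 'm itself) R \<longleftrightarrow> ring R \<and>
     (\<forall>(M :: ('r, 'm) module) P. left_module R M \<and> left_pure R M P \<longrightarrow> direct_summand R M P)"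

definition right_PDS :: "'m itself \<Rightarrow> ('r, 'k) ring_scheme \<Rightarrow> bool" where
  "right_PDS (_ :: 'm itself) R \<longleftrightarrow> ring R \<and>
     (\<forall>(M :: ('r, 'm) module) P. right_module R M \<and> right_pure R M P \<longrightarrow> direct_summand R M P)"

definition PDS :: "'m itself \<Rightarrow> ('r, 'k) ring_scheme \<Rightarrow> bool" where
  "PDS T R \<longleftrightarrow> left_PDS T R \<and> right_PDS T R"

definition left_pure_extending :: "('r, 'k) ring_scheme \<Rightarrow> ('r, 'm) module \<Rightarrow> bool" where
  "left_pure_extending R M \<longleftrightarrow>
     (\<forall>P. left_pure R M P \<longrightarrow> (\<exists>D. direct_summand R M D \<and> essential R (M\<lparr>carrier := D\<rparr>) P))"

definition right_pure_extending :: "('r, 'k) ring_scheme \<Rightarrow> ('r, 'm) module \<Rightarrow> bool" where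
  "right_pure_extending R M \<longleftrightarrow>
     (\<forall>P. right_pure R M P \<longrightarrow> (\<exists>D. direct_summand R M D \<and> essential R (M\<lparr>carrier := D\<rparr>) P))"


section \<open>The induced map on tensor products\<close>

definition module_map ::
    "('r, 'k) ring_scheme \<Rightarrow> ('r, 'a) module \<Rightarrow> ('r, 'm) module \<Rightarrow> ('a \<Rightarrow> 'm) \<Rightarrow> bool" where
  "module_map R A M f \<longleftrightarrow> f \<in> carrier A \<rightarrow> carrier M \<and>
     (\<forall>x\<in>carrier A. \<forall>y\<in>carrier A. f (x \<oplus>\<^bsub>A\<^esub> y) = f x \<oplus>\<^bsub>M\<^esub> f y) \<and>
     (\<forall>r\<in>carrier R. \<forall>x\<in>carrier A. f (r \<odot>\<^bsub>A\<^esub> x) = r \<odot>\<^bsub>M\<^esub> f x)"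

lemma frag_pair_map_simps [simp]:
  "frag_pair_map f g 0 = 0"
  "frag_pair_map f g (frag_of (x, n)) = frag_of (f x, g n)"
  "frag_pair_map f g (a + b) = frag_pair_map f g a + frag_pair_map f g b"
  "frag_pair_map f g (a - b) = frag_pair_map f g a - frag_pair_map f g b"
  "frag_pair_map f g (- a) = - frag_pair_map f g a"
  by (simp_all add: frag_pair_map_def frag_extend_add frag_extend_diff frag_extend_minus)

lemma keys_frag_pair_map:
  assumes "Poly_Mapping.keys z \<subseteq> A \<times> B" "f \<in> A \<rightarrow> A'" "g \<in> B \<rightarrow> B'"
  shows "Poly_Mapping.keys (frag_pair_map f g z) \<subseteq> A' \<times> B'"
proof -
  have "Poly_Mapping.keys (frag_pair_map f g z) \<subseteq>
      (\<Union>p\<in>Poly_Mapping.keys z. Poly_Mapping.keys (case p of (x, n) \<Rightarrow> frag_of (f x, g n)))"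
    unfolding frag_pair_map_def by (rule keys_frag_extend)
  also have "\<dots> \<subseteq> A' \<times> B'"
    using assms by fastforce
  finally show ?thesis .
qed

lemma frag_pair_map_inverse:
  assumes "Poly_Mapping.keys z \<subseteq> A \<times> B"
    and "\<And>x. x \<in> A \<Longrightarrow> f' (f x) = x" "\<And>n. n \<in> B \<Longrightarrow> g' (g n) = n"
  shows "frag_pair_map f' g' (frag_pair_map f g z) = z"
  using assms(1)
  by (induction z rule: frag_induction) (use assms(2,3) in auto)

lemma frag_pair_map_id: "frag_pair_map (\<lambda>x. x) (\<lambda>n. n) z = z"
proof -
  have "Poly_Mapping.keys z \<subseteq> UNIV" by simp
  then show ?thesis
    by (induction z rule: frag_induction) auto
qed

lemma generate_free_Abelian_subset:
  assumes H: "H \<subseteq> C" and C: "0 \<in> C" "\<And>a b. a \<in> C \<Longrightarrow> b \<in> C \<Longrightarrow> a - b \<in> C"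
    and HS: "H \<subseteq> carrier (free_Abelian_group S)"
  shows "generate (free_Abelian_group S) H \<subseteq> C"
proof
  fix z assume "z \<in> generate (free_Abelian_group S) H"
  then show "z \<in> C"
  proof induction
    case one
    then show ?case using C by simp
  next
    case (incl h)
    then show ?case using H by auto
  next
    case (inv h)
    then have "0 - h \<in> C" using C H by blast
    moreover have "Poly_Mapping.keys h \<subseteq> S"
      using subsetD[OF HS inv(1)] by simp
    ultimately show ?case by simp
  next
    case (eng h1 h2)
    then have "h1 - (0 - h2) \<in> C" using C by blast
    then show ?case by simp
  qed
qed

definition mod_closed :: "('r, 'k) ring_scheme \<Rightarrow> ('r, 'm) module \<Rightarrow> 'm set \<Rightarrow> bool" where
  "mod_closed R M H \<longleftrightarrow> (\<forall>x\<in>H. \<forall>y\<in>H. x \<oplus>\<^bsub>M\<^esub> y \<in> H) \<and> (\<forall>r\<in>carrier R. \<forall>x\<in>H. r \<odot>\<^bsub>M\<^esub> x \<in> H)"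

abbreviation closed_carrier :: "('r, 'k) ring_scheme \<Rightarrow> ('r, 'm) module \<Rightarrow> bool" where
  "closed_carrier R M \<equiv> mod_closed R M (carrier M)"

lemma closed_left: "left_module R M \<Longrightarrow> closed_carrier R M"
  unfolding mod_closed_def
  by (auto intro: left_module.smult_closed
      abelian_monoid.a_closed[OF abelian_group.axioms(1)[OF left_module.axioms(2)]])

lemma closed_right: "right_module R M \<Longrightarrow> closed_carrier R M"
  unfolding mod_closed_def
  by (auto intro: right_module.smult_closed
      abelian_monoid.a_closed[OF abelian_group.axioms(1)[OF right_module.axioms(2)]])

lemma submodule_mod_closed: "submodule P R M \<Longrightarrow> mod_closed R M P"
  unfolding mod_closed_def
  using subgroup.m_closed[OF submodule.axioms(1)] submodule.smult_closed by fastforce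

lemma closed_sub: "mod_closed R M P \<Longrightarrow> closed_carrier R (M\<lparr>carrier := P\<rparr>)"
  by (simp add: mod_closed_def)

lemma submodule_subset: "submodule P R M \<Longrightarrow> P \<subseteq> carrier M"
  using subgroup.subset[OF submodule.axioms(1)] by fastforce

lemma keys_diff_le: "Poly_Mapping.keys (a - b) \<subseteq> Poly_Mapping.keys a \<union> Poly_Mapping.keys b"
  for a b :: "'a \<Rightarrow>\<^sub>0 int"
  by (rule keys_diff)

lemma keys_frag_diff2:
  assumes "a \<in> S" "b \<in> S"
  shows "Poly_Mapping.keys (frag_of a - frag_of b) \<subseteq> S"
  using keys_diff_le[of "frag_of a" "frag_of b"] assms by auto

lemma keys_frag_diff3:
  assumes "a \<in> S" "b \<in> S" "c \<in> S"
  shows "Poly_Mapping.keys (frag_of a - frag_of b - frag_of c) \<subseteq> S"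
  using keys_diff_le[of "frag_of a - frag_of b" "frag_of c"] keys_frag_diff2[OF assms(1,2)] assms(3)
  by auto

lemma tensor_relations_subset:
  assumes "closed_carrier R M" "closed_carrier R N"
  shows "tensor_relations R M N \<subseteq> carrier (free_Abelian_group (carrier M \<times> carrier N))"
proof
  fix z assume z: "z \<in> tensor_relations R M N"
  have "Poly_Mapping.keys z \<subseteq> carrier M \<times> carrier N"
    using z unfolding tensor_relations_def
  proof (elim UnE CollectE exE conjE, goal_cases)
    case (1 x y n)
    show ?case
      unfolding 1(1) by (rule keys_frag_diff3) (use 1 assms in \<open>auto simp: mod_closed_def\<close>)
  next
    case (2 x n p)
    show ?case
      unfolding 2(1) by (rule keys_frag_diff3) (use 2 assms in \<open>auto simp: mod_closed_def\<close>)
  next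
    case (3 r x n)
    show ?case
      unfolding 3(1) by (rule keys_frag_diff2) (use 3 assms in \<open>auto simp: mod_closed_def\<close>)
  qed
  then show "z \<in> carrier (free_Abelian_group (carrier M \<times> carrier N))"
    by simp
qed

lemma tensor_kernel_subgroup:
  assumes "closed_carrier R M" "closed_carrier R N"
  shows "subgroup (tensor_kernel R M N) (free_Abelian_group (carrier M \<times> carrier N))"
  unfolding tensor_kernel_def
  by (rule group.generate_is_subgroup[OF group_free_Abelian_group tensor_relations_subset[OF assms]])

lemma tensor_kernel_normal:
  assumes "closed_carrier R M" "closed_carrier R N"
  shows "tensor_kernel R M N \<lhd> free_Abelian_group (carrier M \<times> carrier N)"
  by (rule comm_group.subgroup_imp_normal[OF abelian_free_Abelian_group tensor_kernel_subgroup[OF assms]])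

lemma tensor_kernel_diff:
  assumes "closed_carrier R M" "closed_carrier R N"
    and "a \<in> tensor_kernel R M N" "b \<in> tensor_kernel R M N"
  shows "a - b \<in> tensor_kernel R M N"
proof -
  interpret subgroup "tensor_kernel R M N" "free_Abelian_group (carrier M \<times> carrier N)"
    by (rule tensor_kernel_subgroup[OF assms(1,2)])
  have "Poly_Mapping.keys b \<subseteq> carrier M \<times> carrier N"
    using mem_carrier[OF assms(4)] by simp
  then have "- b \<in> tensor_kernel R M N"
    using m_inv_closed[OF assms(4)] by simp
  then show ?thesis
    using m_closed[OF assms(3), of "- b"] by simp
qed

lemma tensor_kernel_zero: "0 \<in> tensor_kernel R M N"
  using generate.one[of "free_Abelian_group (carrier M \<times> carrier N)"]
  by (simp add: tensor_kernel_def)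

lemma tensor_kernel_map:
  assumes AB: "closed_carrier R A" "closed_carrier R B" and MN: "closed_carrier R M" "closed_carrier R N"
    and f: "module_map R A M f" and g: "module_map R B N g"
    and z: "z \<in> tensor_kernel R A B"
  shows "frag_pair_map f g z \<in> tensor_kernel R M N"
proof -
  have rel: "frag_pair_map f g z \<in> tensor_relations R M N" if "z \<in> tensor_relations R A B" for z
    using that unfolding tensor_relations_def
  proof (elim UnE CollectE exE conjE)
    fix x y n assume "z = frag_of (x \<oplus>\<^bsub>A\<^esub> y, n) - frag_of (x, n) - frag_of (y, n)"
      "x \<in> carrier A" "y \<in> carrier A" "n \<in> carrier B"
    then show "frag_pair_map f g z \<in>
     {frag_of (x \<oplus>\<^bsub>M\<^esub> y, n) - frag_of (x, n) - frag_of (y, n) | x y n.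
        x \<in> carrier M \<and> y \<in> carrier M \<and> n \<in> carrier N} \<union>
     {frag_of (x, n \<oplus>\<^bsub>N\<^esub> p) - frag_of (x, n) - frag_of (x, p) | x n p.
        x \<in> carrier M \<and> n \<in> carrier N \<and> p \<in> carrier N} \<union>
     {frag_of (r \<odot>\<^bsub>M\<^esub> x, n) - frag_of (x, r \<odot>\<^bsub>N\<^esub> n) | r x n.
        r \<in> carrier R \<and> x \<in> carrier M \<and> n \<in> carrier N}"
      using f g unfolding module_map_def
      by (intro UnI1 CollectI exI[of _ "f x"] exI[of _ "f y"] exI[of _ "g n"]) auto
  next
    fix x n p assume "z = frag_of (x, n \<oplus>\<^bsub>B\<^esub> p) - frag_of (x, n) - frag_of (x, p)"
      "x \<in> carrier A" "n \<in> carrier B" "p \<in> carrier B"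
    then show "frag_pair_map f g z \<in>
     {frag_of (x \<oplus>\<^bsub>M\<^esub> y, n) - frag_of (x, n) - frag_of (y, n) | x y n.
        x \<in> carrier M \<and> y \<in> carrier M \<and> n \<in> carrier N} \<union>
     {frag_of (x, n \<oplus>\<^bsub>N\<^esub> p) - frag_of (x, n) - frag_of (x, p) | x n p.
        x \<in> carrier M \<and> n \<in> carrier N \<and> p \<in> carrier N} \<union>
     {frag_of (r \<odot>\<^bsub>M\<^esub> x, n) - frag_of (x, r \<odot>\<^bsub>N\<^esub> n) | r x n.
        r \<in> carrier R \<and> x \<in> carrier M \<and> n \<in> carrier N}"
      using f g unfolding module_map_def
      by (intro UnI1 UnI2 CollectI exI[of _ "f x"] exI[of _ "g n"] exI[of _ "g p"]) auto
  next
    fix r x n assume "z = frag_of (r \<odot>\<^bsub>A\<^esub> x, n) - frag_of (x, r \<odot>\<^bsub>B\<^esub> n)"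
      "r \<in> carrier R" "x \<in> carrier A" "n \<in> carrier B"
    then show "frag_pair_map f g z \<in>
     {frag_of (x \<oplus>\<^bsub>M\<^esub> y, n) - frag_of (x, n) - frag_of (y, n) | x y n.
        x \<in> carrier M \<and> y \<in> carrier M \<and> n \<in> carrier N} \<union>
     {frag_of (x, n \<oplus>\<^bsub>N\<^esub> p) - frag_of (x, n) - frag_of (x, p) | x n p.
        x \<in> carrier M \<and> n \<in> carrier N \<and> p \<in> carrier N} \<union>
     {frag_of (r \<odot>\<^bsub>M\<^esub> x, n) - frag_of (x, r \<odot>\<^bsub>N\<^esub> n) | r x n.
        r \<in> carrier R \<and> x \<in> carrier M \<and> n \<in> carrier N}"
      using f g unfolding module_map_def
      by (intro UnI2 CollectI exI[of _ r] exI[of _ "f x"] exI[of _ "g n"]) auto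
  qed
  have "tensor_kernel R A B \<subseteq> {z. frag_pair_map f g z \<in> tensor_kernel R M N}"
    unfolding tensor_kernel_def[of R A B]
  proof (rule generate_free_Abelian_subset)
    show "tensor_relations R A B \<subseteq> {z. frag_pair_map f g z \<in> tensor_kernel R M N}"
      using rel by (auto simp: tensor_kernel_def intro: generate.incl)
  next
    show "tensor_relations R A B \<subseteq> carrier (free_Abelian_group (carrier A \<times> carrier B))"
      by (rule tensor_relations_subset[OF AB])
  qed (simp_all add: tensor_kernel_zero tensor_kernel_diff[OF MN])
  with z show ?thesis by auto
qed

lemma tensor_map_coset:
  assumes AB: "closed_carrier R A" "closed_carrier R B" and MN: "closed_carrier R M" "closed_carrier R N"
    and f: "module_map R A M f" and g: "module_map R B N g"
  shows "tensor_map R M N f g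
      (tensor_kernel R A B #>\<^bsub>free_Abelian_group (carrier A \<times> carrier B)\<^esub> z) =
    tensor_kernel R M N #>\<^bsub>free_Abelian_group (carrier M \<times> carrier N)\<^esub> frag_pair_map f g z"
    (is "?L = ?R")
proof
  have add: "a + b \<in> tensor_kernel R M N"
    if "a \<in> tensor_kernel R M N" "b \<in> tensor_kernel R M N" for a b
    using subgroup.m_closed[OF tensor_kernel_subgroup[OF MN] that] by simp
  show "?L \<subseteq> ?R"
  proof
    fix w assume "w \<in> ?L"
    then obtain a b where "a \<in> tensor_kernel R M N" "b \<in> tensor_kernel R A B"
      "w = a + (frag_pair_map f g b + frag_pair_map f g z)"
      by (auto simp: tensor_map_def set_mult_def r_coset_def)
    then show "w \<in> ?R"
      using add[OF _ tensor_kernel_map[OF AB MN f g]]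
      by (auto simp: r_coset_def intro!: bexI[of _ "a + frag_pair_map f g b"])
  qed
  show "?R \<subseteq> ?L"
  proof
    fix w assume "w \<in> ?R"
    then obtain a where "a \<in> tensor_kernel R M N" "w = a + frag_pair_map f g (0 + z)"
      by (auto simp: r_coset_def)
    then show "w \<in> ?L"
      using tensor_kernel_zero[of R A B]
      unfolding tensor_map_def set_mult_def r_coset_def mult_free_Abelian_group by blast
  qed
qed

lemma tensor_map_tensor:
  assumes "closed_carrier R A" "closed_carrier R B" "closed_carrier R M" "closed_carrier R N"
    and "module_map R A M f" and "module_map R B N g"
  shows "tensor_map R M N f g (tensor R A B x n) = tensor R M N (f x) (g n)"
  unfolding tensor_def tensor_map_coset[OF assms] by simp

lemma tensor_map_hom:
  assumes AB: "closed_carrier R A" "closed_carrier R B" and MN: "closed_carrier R M" "closed_carrier R N"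
    and f: "module_map R A M f" and g: "module_map R B N g"
  shows "tensor_map R M N f g \<in> hom (tensor_product R A B) (tensor_product R M N)"
proof (rule homI)
  let ?F = "free_Abelian_group (carrier A \<times> carrier B)"
  let ?G = "free_Abelian_group (carrier M \<times> carrier N)"
  note co = tensor_map_coset[OF assms]
  have fg: "f \<in> carrier A \<rightarrow> carrier M" "g \<in> carrier B \<rightarrow> carrier N"
    using f g by (auto simp: module_map_def)
  note ks = keys_frag_pair_map[OF _ fg]
  fix a assume "a \<in> carrier (tensor_product R A B)"
  then obtain y where y: "Poly_Mapping.keys y \<subseteq> carrier A \<times> carrier B"
      "a = tensor_kernel R A B #>\<^bsub>?F\<^esub> y"
    by (auto simp: tensor_product_def carrier_FactGroup)
  then show "tensor_map R M N f g a \<in> carrier (tensor_product R M N)"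
    using ks[OF y(1)] by (auto simp: tensor_product_def carrier_FactGroup co)
  fix b assume "b \<in> carrier (tensor_product R A B)"
  then obtain z where z: "Poly_Mapping.keys z \<subseteq> carrier A \<times> carrier B"
      "b = tensor_kernel R A B #>\<^bsub>?F\<^esub> z"
    by (auto simp: tensor_product_def carrier_FactGroup)
  have ab: "(tensor_kernel R A B #>\<^bsub>?F\<^esub> y) <#>\<^bsub>?F\<^esub> (tensor_kernel R A B #>\<^bsub>?F\<^esub> z) = tensor_kernel R A B #>\<^bsub>?F\<^esub> (y + z)"
    using normal.rcos_sum[OF tensor_kernel_normal[OF AB], of y z] y z by simp
  show "tensor_map R M N f g (a \<otimes>\<^bsub>tensor_product R A B\<^esub> b) =
     tensor_map R M N f g a \<otimes>\<^bsub>tensor_product R M N\<^esub> tensor_map R M N f g b"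
    using normal.rcos_sum[OF tensor_kernel_normal[OF MN], of "frag_pair_map f g y" "frag_pair_map f g z"]
      ks[OF y(1)] ks[OF z(1)]
    by (simp add: tensor_product_def ab co y(2) z(2))
qed

lemma tensor_map_inj_iff:
  assumes AB: "closed_carrier R A" "closed_carrier R B" and MN: "closed_carrier R M" "closed_carrier R N"
    and f: "module_map R A M f" and g: "module_map R B N g"
  shows "inj_on (tensor_map R M N f g) (carrier (tensor_product R A B)) \<longleftrightarrow>
    (\<forall>z. Poly_Mapping.keys z \<subseteq> carrier A \<times> carrier B \<and> frag_pair_map f g z \<in> tensor_kernel R M N
       \<longrightarrow> z \<in> tensor_kernel R A B)" (is "?I \<longleftrightarrow> ?J")
proof -
  let ?F = "free_Abelian_group (carrier A \<times> carrier B)"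
  let ?G = "free_Abelian_group (carrier M \<times> carrier N)"
  note co = tensor_map_coset[OF assms]
  have fg: "f \<in> carrier A \<rightarrow> carrier M" "g \<in> carrier B \<rightarrow> carrier N"
    using f g by (auto simp: module_map_def)
  have eq: "tensor_kernel R C D #>\<^bsub>free_Abelian_group (carrier C \<times> carrier D)\<^esub> y =
      tensor_kernel R C D #>\<^bsub>free_Abelian_group (carrier C \<times> carrier D)\<^esub> z \<longleftrightarrow>
      y - z \<in> tensor_kernel R C D" (is "?K #>\<^bsub>?H\<^esub> y = _ \<longleftrightarrow> _")
    if cl: "closed_carrier R C" "closed_carrier R D"
    for C :: "('a, 'x) module" and D :: "('a, 'y) module" and y z
  proof
    assume eq: "?K #>\<^bsub>?H\<^esub> y = ?K #>\<^bsub>?H\<^esub> z"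
    have "y \<in> ?K #>\<^bsub>?H\<^esub> y"
      using tensor_kernel_zero[of R C D] by (force simp: r_coset_def)
    then show "y - z \<in> ?K"
      unfolding eq by (auto simp: r_coset_def)
  next
    assume yz: "y - z \<in> ?K"
    have add: "a + b \<in> ?K" if "a \<in> ?K" "b \<in> ?K" for a b
      using subgroup.m_closed[OF tensor_kernel_subgroup[OF cl] that] by simp
    have "\<exists>k'\<in>?K. k + y = k' + z" if "k \<in> ?K" for k
      using add[OF that yz] by (intro bexI[of _ "k + (y - z)"]) auto
    moreover have "\<exists>k'\<in>?K. k + z = k' + y" if "k \<in> ?K" for k
      using tensor_kernel_diff[OF cl that yz] by (intro bexI[of _ "k - (y - z)"]) auto
    ultimately show "?K #>\<^bsub>?H\<^esub> y = ?K #>\<^bsub>?H\<^esub> z"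
      by (auto simp: r_coset_def)
  qed
  show ?thesis
  proof
    assume I: ?I
    show ?J
    proof (intro allI impI, elim conjE)
      fix z assume z: "Poly_Mapping.keys z \<subseteq> carrier A \<times> carrier B"
        "frag_pair_map f g z \<in> tensor_kernel R M N"
      have "tensor_map R M N f g (tensor_kernel R A B #>\<^bsub>?F\<^esub> z) =
          tensor_map R M N f g (tensor_kernel R A B #>\<^bsub>?F\<^esub> 0)"
        unfolding co by (subst eq[OF MN]) (use z in simp)
      then have "tensor_kernel R A B #>\<^bsub>?F\<^esub> z = tensor_kernel R A B #>\<^bsub>?F\<^esub> 0"
        by (rule inj_onD[OF I]) (use z in \<open>auto simp: tensor_product_def carrier_FactGroup intro!: imageI\<close>)
      then show "z \<in> tensor_kernel R A B"
        using eq[OF AB, of z 0] by simp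
    qed
  next
    assume J: ?J
    show ?I
    proof (rule inj_onI)
      fix a b assume "a \<in> carrier (tensor_product R A B)" "b \<in> carrier (tensor_product R A B)"
        and ab: "tensor_map R M N f g a = tensor_map R M N f g b"
      then obtain y z where y: "Poly_Mapping.keys y \<subseteq> carrier A \<times> carrier B"
          "a = tensor_kernel R A B #>\<^bsub>?F\<^esub> y"
        and z: "Poly_Mapping.keys z \<subseteq> carrier A \<times> carrier B"
          "b = tensor_kernel R A B #>\<^bsub>?F\<^esub> z"
        by (auto simp: tensor_product_def carrier_FactGroup)
      have "frag_pair_map f g (y - z) \<in> tensor_kernel R M N"
        using ab unfolding y(2) z(2) co by (subst (asm) eq[OF MN]) simp
      moreover have "Poly_Mapping.keys (y - z) \<subseteq> carrier A \<times> carrier B"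
        using keys_diff_le[of y z] y(1) z(1) by blast
      ultimately have "y - z \<in> tensor_kernel R A B"
        using J by blast
      then show "a = b"
        unfolding y(2) z(2) eq[OF AB] .
    qed
  qed
qed


section \<open>Purity with respect to test modules in an arbitrary type\<close>

lemma left_fg_embed:
  fixes N :: "('r, 'n) module"
  assumes N: "left_module R N" and "finite S" "S \<subseteq> carrier N"
  shows "\<exists>H \<phi>. S \<subseteq> H \<and> H \<subseteq> carrier N \<and> \<zero>\<^bsub>N\<^esub> \<in> H \<and> mod_closed R N H \<and> inj_on (\<phi> :: 'n \<Rightarrow> 'r list) H"
  using assms(2,3)
proof (induction S rule: finite_induct)
  interpret left_module R N by (rule N)
  have l0: "r \<odot>\<^bsub>N\<^esub> \<zero>\<^bsub>N\<^esub> = \<zero>\<^bsub>N\<^esub>" if "r \<in> carrier R" for r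
    using smult_r_distr[OF that M.zero_closed M.zero_closed] smult_closed[OF that M.zero_closed]
    by (metis M.add.l_cancel_one M.zero_closed M.l_zero)
  have r0: "\<zero>\<^bsub>R\<^esub> \<odot>\<^bsub>N\<^esub> x = \<zero>\<^bsub>N\<^esub>" if "x \<in> carrier N" for x
    using smult_l_distr[OF R.zero_closed R.zero_closed that] smult_closed[OF R.zero_closed that]
    by (metis M.add.l_cancel_one M.zero_closed R.zero_closed R.l_zero)
  {
    case empty
    show ?case
      by (rule exI[of _ "{\<zero>\<^bsub>N\<^esub>}"]) (auto simp: mod_closed_def l0)
  next
    case (insert s S)
    then obtain H and \<phi> :: "'n \<Rightarrow> 'r list" where H: "S \<subseteq> H" "H \<subseteq> carrier N" "\<zero>\<^bsub>N\<^esub> \<in> H"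
        "mod_closed R N H" "inj_on \<phi> H"
      by auto
    have s: "s \<in> carrier N" using insert by auto
    have Ha: "x \<oplus>\<^bsub>N\<^esub> y \<in> H" if "x \<in> H" "y \<in> H" for x y using H(4) that by (auto simp: mod_closed_def)
    have Hs: "r \<odot>\<^bsub>N\<^esub> x \<in> H" if "r \<in> carrier R" "x \<in> H" for r x
      using H(4) that by (auto simp: mod_closed_def)
    define G where "G = {r \<odot>\<^bsub>N\<^esub> s \<oplus>\<^bsub>N\<^esub> h | r h. r \<in> carrier R \<and> h \<in> H}"
    define \<rho> where "\<rho> x = (SOME p. fst p \<in> carrier R \<and> snd p \<in> H \<and> x = fst p \<odot>\<^bsub>N\<^esub> s \<oplus>\<^bsub>N\<^esub> snd p)" for x
    have \<rho>: "fst (\<rho> x) \<in> carrier R \<and> snd (\<rho> x) \<in> H \<and> x = fst (\<rho> x) \<odot>\<^bsub>N\<^esub> s \<oplus>\<^bsub>N\<^esub> snd (\<rho> x)"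
      if "x \<in> G" for x
      unfolding \<rho>_def by (rule someI_ex) (use that in \<open>auto simp: G_def\<close>)
    have HG: "H \<subseteq> G"
    proof
      fix h assume h: "h \<in> H"
      then have "h = \<zero>\<^bsub>R\<^esub> \<odot>\<^bsub>N\<^esub> s \<oplus>\<^bsub>N\<^esub> h" using H(2) r0[OF s] by auto
      then show "h \<in> G" using h unfolding G_def by blast
    qed
    have "s = \<one>\<^bsub>R\<^esub> \<odot>\<^bsub>N\<^esub> s \<oplus>\<^bsub>N\<^esub> \<zero>\<^bsub>N\<^esub>" using s smult_one by auto
    then have sG: "s \<in> G" using H(3) unfolding G_def by blast
    have "inj_on (\<lambda>x. fst (\<rho> x) # \<phi> (snd (\<rho> x))) G"
    proof (rule inj_onI)
      fix x y assume xy: "x \<in> G" "y \<in> G"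
        "fst (\<rho> x) # \<phi> (snd (\<rho> x)) = fst (\<rho> y) # \<phi> (snd (\<rho> y))"
      then have "snd (\<rho> x) = snd (\<rho> y)" using \<rho> inj_onD[OF H(5)] by auto
      then show "x = y" using xy \<rho> by (metis list.inject)
    qed
    moreover have "G \<subseteq> carrier N"
      using H(2) s by (auto simp: G_def intro!: M.a_closed smult_closed)
    moreover have "mod_closed R N G"
      unfolding mod_closed_def
    proof (intro conjI ballI)
      fix x y assume "x \<in> G" "y \<in> G"
      then obtain a b h k where *: "a \<in> carrier R" "b \<in> carrier R" "h \<in> H" "k \<in> H"
        "x = a \<odot>\<^bsub>N\<^esub> s \<oplus>\<^bsub>N\<^esub> h" "y = b \<odot>\<^bsub>N\<^esub> s \<oplus>\<^bsub>N\<^esub> k" by (auto simp: G_def)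
      have c: "a \<odot>\<^bsub>N\<^esub> s \<in> carrier N" "b \<odot>\<^bsub>N\<^esub> s \<in> carrier N" "h \<in> carrier N" "k \<in> carrier N"
        using * s H(2) smult_closed by auto
      have "x \<oplus>\<^bsub>N\<^esub> y = (a \<oplus>\<^bsub>R\<^esub> b) \<odot>\<^bsub>N\<^esub> s \<oplus>\<^bsub>N\<^esub> (h \<oplus>\<^bsub>N\<^esub> k)"
        using c by (simp add: * smult_l_distr[OF *(1,2) s] M.a_ac)
      then show "x \<oplus>\<^bsub>N\<^esub> y \<in> G"
        unfolding G_def using R.a_closed[OF *(1,2)] Ha[OF *(3,4)] by blast
    next
      fix r x assume r: "r \<in> carrier R" and "x \<in> G"
      then obtain a h where *: "a \<in> carrier R" "h \<in> H" "x = a \<odot>\<^bsub>N\<^esub> s \<oplus>\<^bsub>N\<^esub> h" by (auto simp: G_def)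
      have "r \<odot>\<^bsub>N\<^esub> x = (r \<otimes>\<^bsub>R\<^esub> a) \<odot>\<^bsub>N\<^esub> s \<oplus>\<^bsub>N\<^esub> r \<odot>\<^bsub>N\<^esub> h"
        using * s H(2) r smult_closed by (simp add: smult_assoc subsetD smult_r_distr)
      then show "r \<odot>\<^bsub>N\<^esub> x \<in> G"
        unfolding G_def using R.m_closed[OF r *(1)] Hs[OF r *(2)] by blast
    qed
    ultimately show ?case
      using H(1,3) HG sG by (intro exI conjI) auto
  }
qed

definition transported ::
    "('r, 'n) module \<Rightarrow> 'n set \<Rightarrow> ('n \<Rightarrow> 'b) \<Rightarrow> ('r, 'b) module" where
  "transported N H \<phi> =
     \<lparr>carrier = \<phi> ` H, monoid.mult = undefined, one = undefined, ring.zero = \<phi> \<zero>\<^bsub>N\<^esub>,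
      ring.add = (\<lambda>a b. \<phi> (inv_into H \<phi> a \<oplus>\<^bsub>N\<^esub> inv_into H \<phi> b)),
      smult = (\<lambda>r a. \<phi> (r \<odot>\<^bsub>N\<^esub> inv_into H \<phi> a))\<rparr>"

lemma left_module_transported:
  assumes N: "left_module R N" and H: "H \<subseteq> carrier N" "\<zero>\<^bsub>N\<^esub> \<in> H" "mod_closed R N H" "inj_on \<phi> H"
  shows "left_module R (transported N H \<phi>)"
proof -
  interpret left_module R N by (rule N)
  have Ha: "x \<oplus>\<^bsub>N\<^esub> y \<in> H" if "x \<in> H" "y \<in> H" for x y using H(3) that by (auto simp: mod_closed_def)
  have Hs: "r \<odot>\<^bsub>N\<^esub> x \<in> H" if "r \<in> carrier R" "x \<in> H" for r x
    using H(3) that by (auto simp: mod_closed_def)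
  have Hc: "x \<in> carrier N" if "x \<in> H" for x using H(1) that by auto
  have r0: "\<zero>\<^bsub>R\<^esub> \<odot>\<^bsub>N\<^esub> x = \<zero>\<^bsub>N\<^esub>" if "x \<in> carrier N" for x
    using smult_l_distr[OF R.zero_closed R.zero_closed that] smult_closed[OF R.zero_closed that]
    by (metis M.add.l_cancel_one M.zero_closed R.zero_closed R.l_zero)
  have neg: "(\<ominus>\<^bsub>R\<^esub> \<one>\<^bsub>R\<^esub>) \<odot>\<^bsub>N\<^esub> x \<oplus>\<^bsub>N\<^esub> x = \<zero>\<^bsub>N\<^esub>" if "x \<in> carrier N" for x
    using smult_l_distr[of "\<ominus>\<^bsub>R\<^esub> \<one>\<^bsub>R\<^esub>" "\<one>\<^bsub>R\<^esub>" x] that by (simp add: smult_one r0 R.l_neg)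
  note [simp] = transported_def inv_into_f_f[OF H(4)] Ha Hs Hc H(2)
  show ?thesis
  proof (intro left_module.intro left_module_axioms.intro abelian_groupI R.ring_axioms)
    fix x assume "x \<in> carrier (transported N H \<phi>)"
    then obtain h where "h \<in> H" "x = \<phi> h" by auto
    then show "\<exists>y\<in>carrier (transported N H \<phi>).
        y \<oplus>\<^bsub>transported N H \<phi>\<^esub> x = \<zero>\<^bsub>transported N H \<phi>\<^esub>"
      using neg[of h] by (intro bexI[of _ "\<phi> ((\<ominus>\<^bsub>R\<^esub> \<one>\<^bsub>R\<^esub>) \<odot>\<^bsub>N\<^esub> h)"]) auto
  qed (auto simp: smult_l_distr smult_r_distr smult_assoc smult_one M.a_ac)
qed

text \<open>Right modules are left modules over the opposite ring.\<close>

definition opposite :: "('r, 'k) ring_scheme \<Rightarrow> 'r ring" where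
  "opposite R = \<lparr>carrier = carrier R, monoid.mult = (\<lambda>a b. b \<otimes>\<^bsub>R\<^esub> a), one = \<one>\<^bsub>R\<^esub>,
     ring.zero = \<zero>\<^bsub>R\<^esub>, ring.add = ring.add R\<rparr>"

lemma ring_opposite:
  assumes "ring R" shows "ring (opposite R)"
proof -
  interpret ring R by (rule assms)
  have neg: "\<exists>y\<in>carrier R. y \<oplus>\<^bsub>R\<^esub> x = \<zero>\<^bsub>R\<^esub>" if "x \<in> carrier R" for x
    using that l_neg by blast
  show ?thesis
    by (intro ringI abelian_groupI monoidI)
      (use neg in \<open>auto simp: opposite_def a_ac m_assoc l_distr r_distr\<close>)
qed

lemma ring_of_opposite:
  fixes R :: "('r, 'k) ring_scheme"
  shows "carrier (opposite R) = carrier R" "mod_closed (opposite R) M H = mod_closed R M H"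
  by (auto simp: opposite_def mod_closed_def)

lemma right_module_iff_left_opposite:
  assumes "ring R"
  shows "right_module R M \<longleftrightarrow> left_module (opposite R) M"
proof -
  have "right_module_axioms R M = left_module_axioms (opposite R) M"
    unfolding right_module_axioms_def left_module_axioms_def by (auto simp: opposite_def)
  then show ?thesis
    using assms ring_opposite[OF assms] by (auto simp: right_module_def left_module_def)
qed

lemma right_fg_embed:
  fixes N :: "('r, 'n) module"
  assumes N: "right_module R N" and S: "finite S" "S \<subseteq> carrier N"
  shows "\<exists>H \<phi>. S \<subseteq> H \<and> H \<subseteq> carrier N \<and> \<zero>\<^bsub>N\<^esub> \<in> H \<and> mod_closed R N H \<and> inj_on (\<phi> :: 'n \<Rightarrow> 'r list) H"
  using left_fg_embed[of "opposite R" N S] right_module_iff_left_opposite[of R N] N S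
    right_module.axioms(1)[OF N] by (simp add: ring_of_opposite)

lemma right_module_transported:
  assumes N: "right_module R N" and H: "H \<subseteq> carrier N" "\<zero>\<^bsub>N\<^esub> \<in> H" "mod_closed R N H" "inj_on \<phi> H"
  shows "right_module R (transported N H \<phi>)"
  using left_module_transported[of "opposite R" N H \<phi>] N H
    right_module_iff_left_opposite[OF right_module.axioms(1)[OF N], of N]
    right_module_iff_left_opposite[OF right_module.axioms(1)[OF N], of "transported N H \<phi>"]
  by (simp add: ring_of_opposite)

lemma module_map_transport:
  assumes H: "mod_closed R N H" "inj_on \<phi> H"
  shows "module_map R (N\<lparr>carrier := H\<rparr>) (transported N H \<phi>) \<phi>"
    and "module_map R (transported N H \<phi>) (N\<lparr>carrier := H\<rparr>) (inv_into H \<phi>)"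
  using H by (auto simp: module_map_def transported_def mod_closed_def)

lemma module_map_incl:
  "H \<subseteq> carrier N \<Longrightarrow> module_map R (N\<lparr>carrier := H\<rparr>) N (\<lambda>x. x)"
  by (auto simp: module_map_def)

lemma module_map_id: "module_map R N N (\<lambda>x. x)"
  by (auto simp: module_map_def)

lemma tensor_kernel_finite_right:
  assumes M: "closed_carrier R M" and N: "closed_carrier R N"
    and z: "z \<in> tensor_kernel R M N"
  shows "\<exists>S. finite S \<and> S \<subseteq> carrier N \<and>
    (\<forall>H. S \<subseteq> H \<and> H \<subseteq> carrier N \<and> mod_closed R N H \<longrightarrow> z \<in> tensor_kernel R M (N\<lparr>carrier := H\<rparr>))"
    (is "?Q z")
proof -
  have "tensor_kernel R M N \<subseteq> {z. ?Q z}"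
    unfolding tensor_kernel_def[of R M N]
  proof (rule generate_free_Abelian_subset)
    show "tensor_relations R M N \<subseteq> {z. ?Q z}"
    proof
      fix z assume "z \<in> tensor_relations R M N"
      then have "\<exists>S. finite S \<and> S \<subseteq> carrier N \<and> (\<forall>H. S \<subseteq> H \<and> H \<subseteq> carrier N \<longrightarrow>
          z \<in> tensor_relations R M (N\<lparr>carrier := H\<rparr>))"
        unfolding tensor_relations_def
      proof (elim UnE CollectE exE conjE, goal_cases)
        case (1 x y n)
        then show ?case
          by (intro exI[of _ "{n}"] conjI allI impI UnI1) auto
      next
        case (2 x n p)
        then show ?case
          by (intro exI[of _ "{n, p}"] conjI allI impI UnI1[OF UnI2]) auto
      next
        case (3 r x n)
        then show ?case
          by (intro exI[of _ "{n}"] conjI allI impI UnI2) auto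
      qed
      then obtain S where S: "finite S" "S \<subseteq> carrier N"
        "\<And>H. S \<subseteq> H \<Longrightarrow> H \<subseteq> carrier N \<Longrightarrow> z \<in> tensor_relations R M (N\<lparr>carrier := H\<rparr>)"
        by auto
      have "z \<in> tensor_kernel R M (N\<lparr>carrier := H\<rparr>)" if "S \<subseteq> H" "H \<subseteq> carrier N" for H
        unfolding tensor_kernel_def by (rule generate.incl[OF S(3)[OF that]])
      with S(1,2) show "z \<in> {z. ?Q z}"
        by (intro CollectI exI[of _ S]) simp
    qed
  next
    fix a b assume "a \<in> {z. ?Q z}" "b \<in> {z. ?Q z}"
    then obtain S T where "finite S" "S \<subseteq> carrier N" "finite T" "T \<subseteq> carrier N"
      and "\<forall>H. S \<subseteq> H \<and> H \<subseteq> carrier N \<and> mod_closed R N H \<longrightarrow> a \<in> tensor_kernel R M (N\<lparr>carrier := H\<rparr>)"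
      and "\<forall>H. T \<subseteq> H \<and> H \<subseteq> carrier N \<and> mod_closed R N H \<longrightarrow> b \<in> tensor_kernel R M (N\<lparr>carrier := H\<rparr>)"
      by auto
    then show "a - b \<in> {z. ?Q z}"
      by (intro CollectI exI[of _ "S \<union> T"]) (auto intro!: tensor_kernel_diff M closed_sub)
  next
    show "0 \<in> {z. ?Q z}"
      by (intro CollectI exI[of _ "{}"]) (simp add: tensor_kernel_zero)
  qed (rule tensor_relations_subset[OF M N])
  with z show ?thesis by auto
qed

lemma tensor_kernel_finite_left:
  assumes M: "closed_carrier R M" and N: "closed_carrier R N"
    and z: "z \<in> tensor_kernel R M N"
  shows "\<exists>S. finite S \<and> S \<subseteq> carrier M \<and>
    (\<forall>H. S \<subseteq> H \<and> H \<subseteq> carrier M \<and> mod_closed R M H \<longrightarrow> z \<in> tensor_kernel R (M\<lparr>carrier := H\<rparr>) N)"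
    (is "?Q z")
proof -
  have "tensor_kernel R M N \<subseteq> {z. ?Q z}"
    unfolding tensor_kernel_def[of R M N]
  proof (rule generate_free_Abelian_subset)
    show "tensor_relations R M N \<subseteq> {z. ?Q z}"
    proof
      fix z assume "z \<in> tensor_relations R M N"
      then have "\<exists>S. finite S \<and> S \<subseteq> carrier M \<and> (\<forall>H. S \<subseteq> H \<and> H \<subseteq> carrier M \<longrightarrow>
          z \<in> tensor_relations R (M\<lparr>carrier := H\<rparr>) N)"
        unfolding tensor_relations_def
      proof (elim UnE CollectE exE conjE, goal_cases)
        case (1 x y n)
        then show ?case
          by (intro exI[of _ "{x, y}"] conjI allI impI UnI1) auto
      next
        case (2 x n p)
        then show ?case
          by (intro exI[of _ "{x}"] conjI allI impI UnI1[OF UnI2]) auto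
      next
        case (3 r x n)
        then show ?case
          by (intro exI[of _ "{x}"] conjI allI impI UnI2) auto
      qed
      then obtain S where S: "finite S" "S \<subseteq> carrier M"
        "\<And>H. S \<subseteq> H \<Longrightarrow> H \<subseteq> carrier M \<Longrightarrow> z \<in> tensor_relations R (M\<lparr>carrier := H\<rparr>) N"
        by auto
      have "z \<in> tensor_kernel R (M\<lparr>carrier := H\<rparr>) N" if "S \<subseteq> H" "H \<subseteq> carrier M" for H
        unfolding tensor_kernel_def by (rule generate.incl[OF S(3)[OF that]])
      with S(1,2) show "z \<in> {z. ?Q z}"
        by (intro CollectI exI[of _ S]) simp
    qed
  next
    fix a b assume "a \<in> {z. ?Q z}" "b \<in> {z. ?Q z}"
    then obtain S T where "finite S" "S \<subseteq> carrier M" "finite T" "T \<subseteq> carrier M"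
      and "\<forall>H. S \<subseteq> H \<and> H \<subseteq> carrier M \<and> mod_closed R M H \<longrightarrow> a \<in> tensor_kernel R (M\<lparr>carrier := H\<rparr>) N"
      and "\<forall>H. T \<subseteq> H \<and> H \<subseteq> carrier M \<and> mod_closed R M H \<longrightarrow> b \<in> tensor_kernel R (M\<lparr>carrier := H\<rparr>) N"
      by auto
    then show "a - b \<in> {z. ?Q z}"
      by (intro CollectI exI[of _ "S \<union> T"]) (auto intro!: tensor_kernel_diff N closed_sub)
  next
    show "0 \<in> {z. ?Q z}"
      by (intro CollectI exI[of _ "{}"]) (simp add: tensor_kernel_zero)
  qed (rule tensor_relations_subset[OF M N])
  with z show ?thesis by auto
qed

theorem right_pure_all:
  fixes R :: "('r, 'k) ring_scheme" and M :: "('r, 'm) module" and N :: "('r, 'n) module"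
  assumes M: "right_module R M" and P: "right_pure R M P" and N: "left_module R N"
  shows "inj_on (tensor_map R M N (\<lambda>x. x) (\<lambda>n. n))
    (carrier (tensor_product R (M\<lparr>carrier := P\<rparr>) N))"
proof -
  let ?P = "M\<lparr>carrier := P\<rparr>"
  have sub: "submodule P R M" using P by (simp add: right_pure_def)
  note cM = closed_right[OF M] and cN = closed_left[OF N]
    and cP = closed_sub[OF submodule_mod_closed[OF sub]]
    and iP = module_map_incl[OF submodule_subset[OF sub], of R]
  show ?thesis
    unfolding tensor_map_inj_iff[OF cP cN cM cN iP module_map_id] frag_pair_map_id
  proof (intro allI impI, elim conjE)
    fix z assume kz: "Poly_Mapping.keys z \<subseteq> carrier ?P \<times> carrier N"
      and z: "z \<in> tensor_kernel R M N"
    obtain S where S: "finite S" "S \<subseteq> carrier N"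
      "\<And>H. S \<subseteq> H \<Longrightarrow> H \<subseteq> carrier N \<Longrightarrow> mod_closed R N H \<Longrightarrow>
         z \<in> tensor_kernel R M (N\<lparr>carrier := H\<rparr>)"
      using tensor_kernel_finite_right[OF cM cN z] by auto
    have "finite (S \<union> snd ` Poly_Mapping.keys z)" "S \<union> snd ` Poly_Mapping.keys z \<subseteq> carrier N"
      using S kz by auto
    from left_fg_embed[OF N this] obtain H and \<phi> :: "'n \<Rightarrow> 'r list"
      where H: "S \<subseteq> H" "snd ` Poly_Mapping.keys z \<subseteq> H" "H \<subseteq> carrier N" "\<zero>\<^bsub>N\<^esub> \<in> H"
        "mod_closed R N H" "inj_on \<phi> H" by auto
    let ?H = "N\<lparr>carrier := H\<rparr>" and ?T = "transported N H \<phi>"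
    have T: "left_module R ?T" by (rule left_module_transported[OF N H(3-6)])
    note cH = closed_sub[OF H(5)] and cT = closed_left[OF T]
      and mp = module_map_transport[OF H(5,6)]
    have kH: "Poly_Mapping.keys z \<subseteq> P \<times> H" using kz H(2) by force
    have "z \<in> tensor_kernel R M ?H" by (rule S(3)[OF H(1,3,5)])
    then have 1: "frag_pair_map (\<lambda>x. x) \<phi> z \<in> tensor_kernel R M ?T"
      by (rule tensor_kernel_map[OF cM cH cM cT module_map_id mp(1)])
    have "Poly_Mapping.keys (frag_pair_map (\<lambda>x. x) \<phi> z) \<subseteq> carrier ?P \<times> carrier ?T"
      by (rule keys_frag_pair_map[OF kH]) (auto simp: transported_def)
    moreover have "inj_on (tensor_map R M ?T (\<lambda>x. x) (\<lambda>n. n)) (carrier (tensor_product R ?P ?T))"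
      using P T by (auto simp: right_pure_def)
    ultimately have 2: "frag_pair_map (\<lambda>x. x) \<phi> z \<in> tensor_kernel R ?P ?T"
      using 1 unfolding tensor_map_inj_iff[OF cP cT cM cT iP module_map_id] frag_pair_map_id by blast
    have "frag_pair_map (\<lambda>x. x) (inv_into H \<phi>) (frag_pair_map (\<lambda>x. x) \<phi> z) \<in> tensor_kernel R ?P ?H"
      by (rule tensor_kernel_map[OF cP cT cP cH module_map_id mp(2) 2])
    moreover have "frag_pair_map (\<lambda>x. x) (inv_into H \<phi>) (frag_pair_map (\<lambda>x. x) \<phi> z) = z"
      by (rule frag_pair_map_inverse[OF kH]) (use H(6) in auto)
    ultimately have "z \<in> tensor_kernel R ?P ?H" by simp
    from tensor_kernel_map[OF cP cH cP cN module_map_id module_map_incl[OF H(3)] this]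
    show "z \<in> tensor_kernel R ?P N" by (simp add: frag_pair_map_id)
  qed
qed

theorem left_pure_all:
  fixes R :: "('r, 'k) ring_scheme" and M :: "('r, 'm) module" and N :: "('r, 'n) module"
  assumes M: "left_module R M" and P: "left_pure R M P" and N: "right_module R N"
  shows "inj_on (tensor_map R N M (\<lambda>n. n) (\<lambda>x. x))
    (carrier (tensor_product R N (M\<lparr>carrier := P\<rparr>)))"
proof -
  let ?P = "M\<lparr>carrier := P\<rparr>"
  have sub: "submodule P R M" using P by (simp add: left_pure_def)
  note cM = closed_left[OF M] and cN = closed_right[OF N]
    and cP = closed_sub[OF submodule_mod_closed[OF sub]]
    and iP = module_map_incl[OF submodule_subset[OF sub], of R]
  show ?thesis
    unfolding tensor_map_inj_iff[OF cN cP cN cM module_map_id iP] frag_pair_map_id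
  proof (intro allI impI, elim conjE)
    fix z assume kz: "Poly_Mapping.keys z \<subseteq> carrier N \<times> carrier ?P"
      and z: "z \<in> tensor_kernel R N M"
    obtain S where S: "finite S" "S \<subseteq> carrier N"
      "\<And>H. S \<subseteq> H \<Longrightarrow> H \<subseteq> carrier N \<Longrightarrow> mod_closed R N H \<Longrightarrow>
         z \<in> tensor_kernel R (N\<lparr>carrier := H\<rparr>) M"
      using tensor_kernel_finite_left[OF cN cM z] by auto
    have "finite (S \<union> fst ` Poly_Mapping.keys z)" "S \<union> fst ` Poly_Mapping.keys z \<subseteq> carrier N"
      using S kz by auto
    from right_fg_embed[OF N this] obtain H and \<phi> :: "'n \<Rightarrow> 'r list"
      where H: "S \<subseteq> H" "fst ` Poly_Mapping.keys z \<subseteq> H" "H \<subseteq> carrier N" "\<zero>\<^bsub>N\<^esub> \<in> H"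
        "mod_closed R N H" "inj_on \<phi> H" by auto
    let ?H = "N\<lparr>carrier := H\<rparr>" and ?T = "transported N H \<phi>"
    have T: "right_module R ?T" by (rule right_module_transported[OF N H(3-6)])
    note cH = closed_sub[OF H(5)] and cT = closed_right[OF T]
      and mp = module_map_transport[OF H(5,6)]
    have kH: "Poly_Mapping.keys z \<subseteq> H \<times> P" using kz H(2) by force
    have "z \<in> tensor_kernel R ?H M" by (rule S(3)[OF H(1,3,5)])
    then have 1: "frag_pair_map \<phi> (\<lambda>x. x) z \<in> tensor_kernel R ?T M"
      by (rule tensor_kernel_map[OF cH cM cT cM mp(1) module_map_id])
    have "Poly_Mapping.keys (frag_pair_map \<phi> (\<lambda>x. x) z) \<subseteq> carrier ?T \<times> carrier ?P"
      by (rule keys_frag_pair_map[OF kH]) (auto simp: transported_def)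
    moreover have "inj_on (tensor_map R ?T M (\<lambda>n. n) (\<lambda>x. x)) (carrier (tensor_product R ?T ?P))"
      using P T by (auto simp: left_pure_def)
    ultimately have 2: "frag_pair_map \<phi> (\<lambda>x. x) z \<in> tensor_kernel R ?T ?P"
      using 1 unfolding tensor_map_inj_iff[OF cT cP cT cM module_map_id iP] frag_pair_map_id by blast
    have "frag_pair_map (inv_into H \<phi>) (\<lambda>x. x) (frag_pair_map \<phi> (\<lambda>x. x) z) \<in> tensor_kernel R ?H ?P"
      by (rule tensor_kernel_map[OF cT cP cH cP mp(2) module_map_id 2])
    moreover have "frag_pair_map (inv_into H \<phi>) (\<lambda>x. x) (frag_pair_map \<phi> (\<lambda>x. x) z) = z"
      by (rule frag_pair_map_inverse[OF kH]) (use H(6) in auto)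
    ultimately have "z \<in> tensor_kernel R ?H ?P" by simp
    from tensor_kernel_map[OF cH cP cN cP module_map_incl[OF H(3)] module_map_id this]
    show "z \<in> tensor_kernel R N ?P" by (simp add: frag_pair_map_id)
  qed
qed

end

theory Submission
  imports Defs
begin

text \<open>Purity enters only through PDS, which makes a pure P a direct summand. The summand in
  which P must be essential can thus be P itself: a nonzero X inside P satisfies P \<inter> X =
  X.\<close>

text \<open>
  Over a PDS ring a pure submodule is already a direct summand, and every module is essential in
  itself.
\<close>

lemma submodule_self:
  assumes M: "abelian_group M" and P: "submodule P R M"
  shows "submodule P R (M\<lparr>carrier := P\<rparr>)"
proof -
  have "group ((add_monoid M)\<lparr>carrier := P\<rparr>)"
    using subgroup.subgroup_is_group[OF submodule.axioms(1)[OF P]] abelian_group.a_group[OF M]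
    by blast
  then have "subgroup P (add_monoid (M\<lparr>carrier := P\<rparr>))"
    using group.subgroup_self by fastforce
  then show ?thesis
    using submodule.smult_closed[OF P] by (simp add: submodule_def submodule_axioms_def)
qed

lemma essential_self:
  assumes "abelian_group M" "submodule P R M"
  shows "essential R (M\<lparr>carrier := P\<rparr>) P"
  unfolding essential_def
proof (intro conjI allI impI)
  show "submodule P R (M\<lparr>carrier := P\<rparr>)"
    by (rule submodule_self[OF assms])
next
  fix X assume X: "submodule X R (M\<lparr>carrier := P\<rparr>) \<and> X \<noteq> {\<zero>\<^bsub>M\<lparr>carrier := P\<rparr>\<^esub>}"
  then have "X \<subseteq> P"
    using submodule_subset by fastforce
  with X show "P \<inter> X \<noteq> {\<zero>\<^bsub>M\<lparr>carrier := P\<rparr>\<^esub>}"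
    by (simp add: Int_absorb1)
qed

theorem proposition30:
  fixes R :: "('r, 'k) ring_scheme"
  assumes "PDS TYPE('m) R"
  shows "(\<forall>M :: ('r, 'm) module. right_module R M \<longrightarrow> right_pure_extending R M) \<and>
         (\<forall>M :: ('r, 'm) module. left_module R M \<longrightarrow> left_pure_extending R M)"
proof -
  \<comment> \<open>The witness is D = P. Summands and essentiality are defined without reference to
    a side, so this one fact serves left and right modules.\<close>
  have "\<exists>D. direct_summand R M D \<and> essential R (M\<lparr>carrier := D\<rparr>) P"
    if "abelian_group M" "direct_summand R M P" for M :: "('r, 'm) module" and P
    using that essential_self unfolding direct_summand_def by blast
  with assms left_module.axioms(2) right_module.axioms(2) show ?thesis
    unfolding PDS_def left_PDS_def right_PDS_def left_pure_extending_def right_pure_extending_def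
    by blast
qed

end
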